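(* Let $\epsilon>0$ and let $n$ be a positive integer. If $G$ is a graph with $N\ge 128\epsilon^{-3}n$ vertices and $\epsilon N^2$ edges, then $G$ contains (as a subgraph) every bipartite graph $H=(U_1,U_2;F)$ with parts $U_1,U_2$ and $n$ vertices in which every vertex of $U_2$ has degree $2$. *)

theory Defs
  imports Complex_Main
begin

text \<open>Graphs are finite, simple and undirected; edges are two-element sets of vertices.\<close>

record 'a ugraph =
  verts :: "'a set"
  edges :: "'a set set"

definition simple_graph :: "'a ugraph \<Rightarrow> bool" where
  "simple_graph G \<longleftrightarrow> finite (verts G) \<and> (\<forall>e\<in>edges G. e \<subseteq> verts G \<and> card e = 2)"

definition degree :: "'a ugraph \<Rightarrow> 'a \<Rightarrow> nat" where
  "degree G v = card {e \<in> edges G. v \<in> e}"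

text \<open>The parts are allowed to be empty, and isolated vertices are allowed.\<close>

definition bipartite_with_parts :: "'a ugraph \<Rightarrow> 'a set \<Rightarrow> 'a set \<Rightarrow> bool" where
  "bipartite_with_parts H U1 U2 \<longleftrightarrow>
     simple_graph H \<and> verts H = U1 \<union> U2 \<and> U1 \<inter> U2 = {} \<and>
     (\<forall>e\<in>edges H. \<exists>u\<in>U1. \<exists>v\<in>U2. e = {u, v})"

text \<open>A subgraph need not be induced.\<close>

definition subgraph :: "'a ugraph \<Rightarrow> 'a ugraph \<Rightarrow> bool" where
  "subgraph K G \<longleftrightarrow> simple_graph K \<and> verts K \<subseteq> verts G \<and> edges K \<subseteq> edges G"

definition graph_iso :: "'a ugraph \<Rightarrow> 'b ugraph \<Rightarrow> bool" where
  "graph_iso H K \<longleftrightarrow>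
     (\<exists>f. bij_betw f (verts H) (verts K) \<and> edges K = (\<lambda>e. f ` e) ` edges H)"

definition contains_graph :: "'a ugraph \<Rightarrow> 'b ugraph \<Rightarrow> bool" where
  "contains_graph G H \<longleftrightarrow> (\<exists>K. subgraph K G \<and> graph_iso H K)"

end

theory Submission
  imports Defs "HOL-Combinatorics.Permutations" "HOL-Analysis.Convex"
begin

text \<open>
  Dependent random choice, with pairs weighted by the inverse of their codegree. Pass to a cut
  \<open>(X, Y)\<close> of \<open>G\<close> that keeps half of the edges, and choose \<open>t \<in> Y\<close> at random. A pair in
  \<open>X\<close> with \<open>c\<close> common neighbours in \<open>Y\<close> lies in \<open>N(t)\<close> for exactly \<open>c\<close> choices of \<open>t\<close>, so
  summing \<open>1/c\<close> over the pairs in \<open>N(t)\<close>, and then over \<open>t\<close>, gives at most \<open>N\<^sup>2\<close>. Hence for some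
  \<open>t\<close> the set \<open>N(t)\<close> is large and the average of \<open>1/c\<close> over its pairs is at most \<open>1/n\<close>. A random
  injection of \<open>U1\<close> into \<open>N(t)\<close> then makes the sum of \<open>1/c\<close> over the pairs of neighbours of the
  vertices of \<open>U2\<close> at most 1. In increasing order of \<open>c\<close>, the \<open>i\<close>-th such vertex has \<open>c \<ge> i\<close>
  candidates in \<open>Y\<close>, so \<open>U2\<close> can be embedded greedily.
\<close>

section \<open>Cuts that keep half of the edges\<close>

text \<open>Add the vertices one at a time, each on the side opposite to the majority of its earlier
  neighbours. At least half of the new edges are then cut: either \<open>P\<close> with
  \<open>v\<close> outside \<open>S\<close>, or \<open>Q\<close> with \<open>v\<close> put into
  \<open>S\<close>.\<close>

lemma exists_half_cut:
  assumes "finite V" "\<forall>e\<in>E. e \<subseteq> V \<and> card e = 2"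
  shows "\<exists>S\<subseteq>V. card E \<le> 2 * card {e \<in> E. \<exists>x\<in>S. \<exists>y\<in>V - S. e = {x, y}}"
  using assms
proof (induction V arbitrary: E rule: finite_induct)
  case empty
  then have "E = {}" by auto
  then show ?case by simp
next
  case (insert v V)
  have finE: "finite E"
    by (rule finite_subset[of _ "Pow (insert v V)"]) (use insert in auto)
  define E0 where "E0 = {e \<in> E. v \<notin> e}"
  have "\<forall>e\<in>E0. e \<subseteq> V \<and> card e = 2"
    using insert.prems unfolding E0_def by blast
  from insert.IH[OF this] obtain S where S: "S \<subseteq> V"
    and cut: "card E0 \<le> 2 * card {e \<in> E0. \<exists>x\<in>S. \<exists>y\<in>V - S. e = {x, y}}" (is "_ \<le> 2 * card ?C") by blast
  define P where "P = {e \<in> E. \<exists>x\<in>S. e = {x, v}}"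
  define Q where "Q = {e \<in> E. \<exists>x\<in>V - S. e = {v, x}}"
  have v_notin: "v \<notin> S" using S insert.hyps by auto
  have split: "E = E0 \<union> (P \<union> Q)"
  proof -
    have "e \<in> P \<union> Q" if e: "e \<in> E" "v \<in> e" for e
    proof -
      from insert.prems e have "card e = 2" "e \<subseteq> insert v V" by auto
      then obtain x where x: "e = {v, x}" "x \<noteq> v"
        using e(2) by (auto simp: card_2_iff)
      then have "x \<in> V" using \<open>e \<subseteq> insert v V\<close> by auto
      then show ?thesis using x e(1) unfolding P_def Q_def by (auto simp: insert_commute)
    qed
    then show ?thesis unfolding E0_def P_def Q_def by blast
  qed
  have fins: "finite E0" "finite P" "finite Q"
    using finE unfolding E0_def P_def Q_def by auto
  have "card E \<le> card E0 + card (P \<union> Q)"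
    by (subst split) (rule card_Un_le)
  also have "\<dots> \<le> card E0 + (card P + card Q)"
    using card_Un_le[of P Q] by simp
  finally have le: "card E \<le> card E0 + (card P + card Q)" .
  have disj: "?C \<inter> P = {}" "?C \<inter> Q = {}"
    unfolding E0_def P_def Q_def by auto
  show ?case
  proof (cases "card P \<ge> card Q")
    case True
    have "card ?C + card P = card (?C \<union> P)"
      using disj fins by (simp add: card_Un_disjoint)
    also have "\<dots> \<le> card {e \<in> E. \<exists>x\<in>S. \<exists>y\<in>insert v V - S. e = {x, y}}"
    proof (rule card_mono)
      show "?C \<union> P \<subseteq> {e \<in> E. \<exists>x\<in>S. \<exists>y\<in>insert v V - S. e = {x, y}}"
        using v_notin unfolding E0_def P_def by blast
    qed (use finE in auto)
    finally have "card E \<le> 2 * card {e \<in> E. \<exists>x\<in>S. \<exists>y\<in>insert v V - S. e = {x, y}}"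
      using le cut True by linarith
    then show ?thesis using S by blast
  next
    case False
    have "card ?C + card Q = card (?C \<union> Q)"
      using disj fins by (simp add: card_Un_disjoint)
    also have "\<dots> \<le> card {e \<in> E. \<exists>x\<in>insert v S. \<exists>y\<in>insert v V - insert v S. e = {x, y}}"
    proof (rule card_mono)
      show "?C \<union> Q \<subseteq> {e \<in> E. \<exists>x\<in>insert v S. \<exists>y\<in>insert v V - insert v S. e = {x, y}}"
        using insert.hyps(2) unfolding E0_def Q_def by blast
    qed (use finE in auto)
    finally have "card E \<le> 2 * card {e \<in> E. \<exists>x\<in>insert v S. \<exists>y\<in>insert v V - insert v S. e = {x, y}}"
      using le cut False by linarith
    moreover have "insert v S \<subseteq> insert v V" using S by auto
    ultimately show ?thesis by blast
  qed
qed

section \<open>Distinct representatives\<close>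

text \<open>The largest set \<open>C m\<close> has at least \<open>card I\<close> elements, since
  otherwise each of the \<open>card I\<close> terms would exceed \<open>1 / card I\<close>.
  Representing the other sets first uses up \<open>card I - 1\<close> values and so leaves one free
  in \<open>C m\<close>.\<close>

lemma distinct_representatives_if_sum_inverse_card_le_1:
  fixes C :: "'i \<Rightarrow> 'a set"
  assumes "finite I" "\<And>i. i \<in> I \<Longrightarrow> finite (C i) \<and> C i \<noteq> {}"
    and "(\<Sum>i\<in>I. 1 / real (card (C i))) \<le> 1"
  shows "\<exists>g. inj_on g I \<and> (\<forall>i\<in>I. g i \<in> C i)"
  using assms
proof (induction "card I" arbitrary: I)
  case 0
  then show ?case by auto
next
  case (Suc k)
  then have "I \<noteq> {}" by auto
  obtain m where m: "m \<in> I" "\<And>i. i \<in> I \<Longrightarrow> card (C i) \<le> card (C m)"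
  proof -
    have "Max ((card \<circ> C) ` I) \<in> (card \<circ> C) ` I"
      using Suc.prems(1) \<open>I \<noteq> {}\<close> by (intro Max_in) auto
    then obtain m where "m \<in> I" "Max ((card \<circ> C) ` I) = card (C m)" by auto
    then show ?thesis using that[of m] Suc.prems(1)
      by (metis Max_ge comp_apply finite_imageI image_eqI)
  qed
  have pos: "card (C i) > 0" if "i \<in> I" for i
    using Suc.prems(2)[OF that] by (simp add: card_gt_0_iff)
  have "real (card I) * (1 / real (card (C m))) \<le> (\<Sum>i\<in>I. 1 / real (card (C i)))"
    using m(2) pos by (intro sum_bounded_below) (simp add: frac_le)
  also have "\<dots> \<le> 1" by fact
  finally have ge: "card I \<le> card (C m)"
    using pos[OF m(1)] by (simp add: field_simps)
  have "(\<Sum>i\<in>I - {m}. 1 / real (card (C i))) \<le> (\<Sum>i\<in>I. 1 / real (card (C i)))"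
    using Suc.prems(1) by (intro sum_mono2) auto
  then obtain g where g: "inj_on g (I - {m})" "\<forall>i\<in>I - {m}. g i \<in> C i"
    using Suc.hyps(1)[of "I - {m}"] Suc.hyps(2) Suc.prems m(1) by fastforce
  have "card (g ` (I - {m})) < card (C m)"
    using g(1) ge Suc.hyps(2) m(1) Suc.prems(1) by (simp add: card_image)
  then obtain y where y: "y \<in> C m" "y \<notin> g ` (I - {m})"
    by (metis Suc.prems(1) card_mono finite_Diff finite_imageI not_less subsetI)
  have "inj_on (g(m := y)) I"
    using g(1) y(2) by (auto simp: inj_on_def)
  moreover have "\<forall>i\<in>I. (g(m := y)) i \<in> C i" using g(2) y(1) by auto
  ultimately show ?case by blast
qed

section \<open>Averaging over permutations\<close>

text \<open>One transposition takes \<open>a\<close> to \<open>x\<close>. A second one takes the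
  current image of \<open>b\<close> to \<open>y\<close>, and it fixes \<open>x\<close> because
  \<open>x\<close> differs from both of these points.\<close>

lemma exists_permutes_mapping_pair:
  assumes "a \<in> A" "b \<in> A" "a \<noteq> b" "x \<in> A" "y \<in> A" "x \<noteq> y"
  shows "\<exists>s. s permutes A \<and> s a = x \<and> s b = y"
proof -
  define p where "p = transpose a x"
  have p: "p permutes A" "p a = x"
    using assms unfolding p_def by (auto intro: permutes_swap_id)
  have "p b \<noteq> x" using p(2) assms(3) permutes_inj[OF p(1)] by (metis injD)
  moreover have "p b \<in> A" using p(1) assms(2) by (simp add: permutes_in_image)
  ultimately have "transpose (p b) y \<circ> p permutes A" "(transpose (p b) y \<circ> p) a = x"
      "(transpose (p b) y \<circ> p) b = y"
    using p assms by (auto intro: permutes_compose permutes_swap_id simp: transpose_def)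
  then show ?thesis by blast
qed

text \<open>
  Reindexing by a permutation shows that the left-hand sum does not depend on the pair
  \<open>(a, b)\<close>, so it can be computed by averaging over all pairs.
\<close>
lemma sum_permutations_pair:
  fixes w :: "'a \<Rightarrow> 'a \<Rightarrow> real"
  assumes A: "finite A" and ab: "a \<in> A" "b \<in> A" "a \<noteq> b"
  shows "real (card A * (card A - 1)) * (\<Sum>p | p permutes A. w (p a) (p b))
    = fact (card A) * (\<Sum>x\<in>A. \<Sum>y\<in>A - {x}. w x y)"
proof -
  define T where "T x y = (\<Sum>p | p permutes A. w (p x) (p y))" for x y
  have T: "T x y = T a b" if xy: "x \<in> A" "y \<in> A - {x}" for x y
  proof -
    obtain s where s: "s permutes A" "s a = x" "s b = y"
      using exists_permutes_mapping_pair[OF ab, of x y] xy by auto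
    have "T a b = (\<Sum>p | p permutes A. w ((p \<circ> s) a) ((p \<circ> s) b))"
      unfolding T_def by (rule sum_permutations_compose_right[OF s(1)])
    then show ?thesis using s by (simp add: T_def)
  qed
  have "(\<Sum>x\<in>A. \<Sum>y\<in>A - {x}. T x y) = (\<Sum>x\<in>A. \<Sum>y\<in>A - {x}. T a b)"
    using T by (intro sum.cong) auto
  also have "\<dots> = real (card A * (card A - 1)) * T a b"
    using A by simp
  finally have 1: "(\<Sum>x\<in>A. \<Sum>y\<in>A - {x}. T x y) = real (card A * (card A - 1)) * T a b" .
  \<comment> \<open>The same total with the permutation sum outermost: each \<open>p\<close> only
    rearranges the ordered pairs of distinct elements, so all the inner sums agree.\<close>
  have "(\<Sum>x\<in>A. \<Sum>y\<in>A - {x}. T x y)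
      = (\<Sum>p | p permutes A. \<Sum>x\<in>A. \<Sum>y\<in>A - {x}. w (p x) (p y))"
    unfolding T_def by (rule trans[OF sum.cong[OF refl sum.swap] sum.swap])
  also have "\<dots> = (\<Sum>p | p permutes A. \<Sum>x\<in>A. \<Sum>y\<in>A - {x}. w x y)"
  proof (rule sum.cong[OF refl])
    fix p assume "p \<in> {p. p permutes A}"
    then have p: "p permutes A" by simp
    have "(\<Sum>y\<in>A - {x}. w (p x) (p y)) = (\<Sum>y\<in>A - {p x}. w (p x) y)" for x
    proof (rule sum.reindex_bij_betw)
      have "p ` (A - {x}) = A - {p x}"
        using permutes_inj[OF p] permutes_image[OF p] by (simp add: image_set_diff)
      then show "bij_betw p (A - {x}) (A - {p x})"
        using inj_on_subset[OF permutes_inj[OF p] subset_UNIV] by (simp add: bij_betw_def)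
    qed
    then have "(\<Sum>x\<in>A. \<Sum>y\<in>A - {x}. w (p x) (p y)) = (\<Sum>x\<in>A. \<Sum>y\<in>A - {p x}. w (p x) y)"
      by simp
    also have "\<dots> = (\<Sum>x\<in>A. \<Sum>y\<in>A - {x}. w x y)"
      by (rule sum.reindex_bij_betw[OF permutes_imp_bij[OF p]])
    finally show "(\<Sum>x\<in>A. \<Sum>y\<in>A - {x}. w (p x) (p y)) = (\<Sum>x\<in>A. \<Sum>y\<in>A - {x}. w x y)" .
  qed
  also have "\<dots> = fact (card A) * (\<Sum>x\<in>A. \<Sum>y\<in>A - {x}. w x y)"
    using A by (simp add: card_permutations[OF refl])
  finally show ?thesis using 1 unfolding T_def by simp
qed

text \<open>Under a uniformly random \<open>p\<close>, each pair \<open>(a i, b i)\<close> lands on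
  a uniform ordered pair of distinct elements. The right-hand side is thus the mean of the left-hand
  side, and some \<open>p\<close> does not exceed the mean. Keeping the number of pairs as a factor
  avoids a division.\<close>

lemma exists_permutation_sum_pairs_le:
  fixes w :: "'a \<Rightarrow> 'a \<Rightarrow> real"
  assumes A: "finite A"
    and ab: "\<And>i. i \<in> J \<Longrightarrow> a i \<in> A \<and> b i \<in> A \<and> a i \<noteq> b i"
  shows "\<exists>p. p permutes A \<and> real (card A * (card A - 1)) * (\<Sum>i\<in>J. w (p (a i)) (p (b i)))
    \<le> real (card J) * (\<Sum>x\<in>A. \<Sum>y\<in>A - {x}. w x y)"
    (is "\<exists>p. _ \<and> ?D * ?F p \<le> ?R")
proof (rule ccontr)
  assume "\<not> ?thesis"
  then have less: "?R < ?D * ?F p" if "p permutes A" for p using that by force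
  have "fact (card A) * ?R = (\<Sum>p | p permutes A. ?R)"
    using A by (simp add: card_permutations[OF refl])
  \<comment> \<open>Strictness needs at least one permutation; \<open>id\<close> serves.\<close>
  also have "\<dots> < (\<Sum>p | p permutes A. ?D * ?F p)"
    using less A by (intro sum_strict_mono) (auto simp: finite_permutations intro: exI[of _ id] permutes_id)
  also have "\<dots> = (\<Sum>i\<in>J. ?D * (\<Sum>p | p permutes A. w (p (a i)) (p (b i))))"
    by (simp only: sum_distrib_left) (rule sum.swap)
  also have "\<dots> = (\<Sum>i\<in>J. fact (card A) * (\<Sum>x\<in>A. \<Sum>y\<in>A - {x}. w x y))"
    using ab by (intro sum.cong refl sum_permutations_pair[OF A]) auto
  also have "\<dots> = fact (card A) * ?R" by simp
  finally show False by simp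
qed

section \<open>Dependent random choice\<close>

text \<open>If every \<open>t\<close> failed, each squared degree would be bounded in terms of the
  weight of its neighbourhood. The total weight is at most \<open>N ^ 2\<close>, so Cauchy-Schwarz
  would bound \<open>card R ^ 2\<close> by exactly the left-hand side of
  \<open>large\<close>.\<close>

lemma dependent_choice_inverse_codegree:
  fixes R :: "('a \<times> 'b) set" and n N :: nat
  defines "nb t \<equiv> {x. (x, t) \<in> R}"
    and "cod x y \<equiv> {t. (x, t) \<in> R \<and> (y, t) \<in> R}"
  assumes R: "R \<subseteq> X \<times> Y" and X: "finite X" "card X \<le> N" and Y: "finite Y" "card Y \<le> N"
    and large: "real N ^ 3 * real (n + 1) + real n ^ 2 * real N ^ 2 < real (card R) ^ 2"
  shows "\<exists>t\<in>Y. n \<le> card (nb t) \<and>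
    real n * (\<Sum>x\<in>nb t. \<Sum>y\<in>nb t - {x}. 1 / real (card (cod x y)))
      \<le> real (card (nb t) * (card (nb t) - 1))"
proof (rule ccontr)
  define d where "d t = card (nb t)" for t
  define W where "W t = (\<Sum>x\<in>nb t. \<Sum>y\<in>nb t - {x}. 1 / real (card (cod x y)))" for t
  assume none: "\<not> ?thesis"
  have nbX: "nb t \<subseteq> X" for t using R unfolding nb_def by auto
  have fin_nb: "finite (nb t)" for t using nbX X(1) finite_subset by blast
  have W_nonneg: "W t \<ge> 0" for t unfolding W_def by (intro sum_nonneg) auto
  \<comment> \<open>One bound for both ways to fail: \<open>n * W t\<close> covers large
    neighbourhoods of too much weight, and \<open>n ^ 2\<close> covers neighbourhoods with fewer
    than \<open>n\<close> elements.\<close>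
  have small: "real (d t) ^ 2 - real (d t) \<le> real n * W t + real n ^ 2" if "t \<in> Y" for t
  proof (cases "n \<le> d t")
    case True
    have "real (d t * (d t - 1)) < real n * W t"
      using none that True unfolding d_def W_def by force
    moreover have "real (d t * (d t - 1)) = real (d t) ^ 2 - real (d t)"
      by (cases "d t") (auto simp: power2_eq_square algebra_simps)
    ultimately show ?thesis by (smt (verit) zero_le_power2)
  next
    case False
    then have "real (d t) ^ 2 \<le> real n ^ 2" by simp
    moreover have "0 \<le> real n * W t" using W_nonneg by simp
    ultimately show ?thesis by linarith
  qed
  have cardR: "card R = (\<Sum>t\<in>Y. d t)"
  proof -
    have "R = (\<lambda>(t, x). (x, t)) ` (SIGMA t:Y. nb t)"
      using R unfolding nb_def by force
    moreover have "inj_on (\<lambda>(t, x). (x, t)) (SIGMA t:Y. nb t)" by (auto simp: inj_on_def)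
    ultimately have "card R = card (SIGMA t:Y. nb t)" by (simp add: card_image)
    then show ?thesis using Y(1) fin_nb by (simp add: d_def)
  qed
  have "(\<Sum>t\<in>Y. W t) \<le> real N ^ 2"
  proof -
    have fin_cod: "finite (cod x y)" for x y
      using R Y(1) unfolding cod_def by (auto intro: finite_subset[of _ Y])
    \<comment> \<open>With an indicator the range of the pairs no longer depends on
      \<open>t\<close>, so the sum over \<open>t\<close> can be moved inside.\<close>
    have "W t = (\<Sum>x\<in>X. \<Sum>y\<in>X - {x}. if t \<in> cod x y then 1 / real (card (cod x y)) else 0)" for t
    proof -
      have "(\<Sum>x\<in>X. \<Sum>y\<in>X - {x}. if t \<in> cod x y then 1 / real (card (cod x y)) else 0)
          = (\<Sum>x\<in>nb t. \<Sum>y\<in>X - {x}. if t \<in> cod x y then 1 / real (card (cod x y)) else 0)"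
        by (rule sum.mono_neutral_right[OF X(1) nbX]) (auto simp: nb_def cod_def)
      also have "\<dots> = (\<Sum>x\<in>nb t. \<Sum>y\<in>nb t - {x}. 1 / real (card (cod x y)))"
      proof (rule sum.cong[OF refl])
        fix x assume x: "x \<in> nb t"
        have "(\<Sum>y\<in>X - {x}. if t \<in> cod x y then 1 / real (card (cod x y)) else 0)
          = (\<Sum>y\<in>nb t - {x}. if t \<in> cod x y then 1 / real (card (cod x y)) else 0)"
          using nbX[of t] X(1) by (intro sum.mono_neutral_right) (auto simp: nb_def cod_def)
        also have "\<dots> = (\<Sum>y\<in>nb t - {x}. 1 / real (card (cod x y)))"
          using x by (intro sum.cong) (auto simp: nb_def cod_def)
        finally show "(\<Sum>y\<in>X - {x}. if t \<in> cod x y then 1 / real (card (cod x y)) else 0)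
          = (\<Sum>y\<in>nb t - {x}. 1 / real (card (cod x y)))" .
      qed
      finally show ?thesis unfolding W_def by simp
    qed
    then have "(\<Sum>t\<in>Y. W t)
        = (\<Sum>x\<in>X. \<Sum>y\<in>X - {x}. \<Sum>t\<in>Y. if t \<in> cod x y then 1 / real (card (cod x y)) else 0)"
      by (simp only:) (rule trans[OF sum.swap sum.cong[OF refl sum.swap]])
    also have "\<dots> \<le> (\<Sum>x\<in>X. \<Sum>y\<in>X - {x}. 1)"
    proof (intro sum_mono)
      fix x y
      have "cod x y \<subseteq> Y" using R unfolding cod_def by auto
      then have "Y \<inter> cod x y = cod x y" by auto
      then have "(\<Sum>t\<in>Y. if t \<in> cod x y then 1 / real (card (cod x y)) else 0)
          = real (card (cod x y)) * (1 / real (card (cod x y)))"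
        using Y(1) by (simp flip: sum.inter_restrict)
      \<comment> \<open>The product is 1, or 0 for a pair without common neighbours, where
        \<open>1 / 0 = 0\<close>.\<close>
      then show "(\<Sum>t\<in>Y. if t \<in> cod x y then 1 / real (card (cod x y)) else 0) \<le> 1" by simp
    qed
    also have "\<dots> \<le> (\<Sum>x\<in>X. \<Sum>y\<in>X. 1)"
      using X(1) by (intro sum_mono sum_mono2) auto
    also have "\<dots> \<le> real N ^ 2"
      using X by (simp add: power2_eq_square mult_mono flip: of_nat_mult)
    finally show ?thesis .
  qed
  then have W_le: "real n * (\<Sum>t\<in>Y. W t) \<le> real n * real N ^ 2" by (intro mult_left_mono) auto
  \<comment> \<open>Pays for the linear term in \<open>d t * (d t - 1)\<close>; this is the
    \<open>+ 1\<close> in the factor \<open>n + 1\<close> of \<open>large\<close>.\<close>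
  have d_le: "(\<Sum>t\<in>Y. real (d t)) \<le> real N ^ 2"
  proof -
    have "d t \<le> N" for t using card_mono[OF X(1) nbX] X(2) unfolding d_def by (meson le_trans)
    then have "(\<Sum>t\<in>Y. real (d t)) \<le> real (card Y) * real N" by (intro sum_bounded_above) simp
    also have "\<dots> \<le> real N * real N" using Y by (intro mult_right_mono) auto
    finally show ?thesis by (simp add: power2_eq_square)
  qed
  have nY: "real (card Y) * real n ^ 2 \<le> real N * real n ^ 2"
    using Y by (intro mult_right_mono) auto
  have "real (card R) ^ 2 \<le> real (card Y) * (\<Sum>t\<in>Y. real (d t) ^ 2)"
    using Cauchy_Schwarz_ineq_sum[of "\<lambda>_. 1" "\<lambda>t. real (d t)" Y] by (simp add: cardR)
  also have "\<dots> \<le> real N * (\<Sum>t\<in>Y. real (d t) ^ 2)"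
    using Y by (intro mult_right_mono sum_nonneg) auto
  also have "\<dots> \<le> real N * (real n * real N ^ 2 + real N * real n ^ 2 + real N ^ 2)"
  proof (rule mult_left_mono)
    have "(\<Sum>t\<in>Y. real (d t) ^ 2) \<le> (\<Sum>t\<in>Y. real n * W t + real n ^ 2 + real (d t))"
      using small by (intro sum_mono) force
    also have "\<dots> = real n * (\<Sum>t\<in>Y. W t) + real (card Y) * real n ^ 2 + (\<Sum>t\<in>Y. real (d t))"
      by (simp add: sum.distrib sum_distrib_left)
    finally show "(\<Sum>t\<in>Y. real (d t) ^ 2) \<le> real n * real N ^ 2 + real N * real n ^ 2 + real N ^ 2"
      using W_le d_le nY by linarith
  qed simp
  also have "\<dots> = real N ^ 3 * real (n + 1) + real n ^ 2 * real N ^ 2"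
    by (simp add: algebra_simps power2_eq_square power3_eq_cube)
  finally show False using large by simp
qed

section \<open>Embeddings and the neighbours of \<open>U2\<close>\<close>

lemma contains_graph_if_embedding:
  assumes "simple_graph H" "inj_on f (verts H)" "f ` verts H \<subseteq> verts G"
    and "\<And>e. e \<in> edges H \<Longrightarrow> f ` e \<in> edges G"
  shows "contains_graph G H"
proof -
  define K where "K = \<lparr>verts = f ` verts H, edges = (\<lambda>e. f ` e) ` edges H\<rparr>"
  have "card (f ` e) = 2" if "e \<in> edges H" for e
    using assms(1,2) that unfolding simple_graph_def by (metis card_image inj_on_subset)
  then have "simple_graph K"
    using assms(1) unfolding simple_graph_def K_def by auto
  then have "subgraph K G" using assms unfolding subgraph_def K_def by auto
  moreover have "graph_iso H K"
    using assms(2) unfolding graph_iso_def K_def by (auto simp: bij_betw_def)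
  ultimately show ?thesis unfolding contains_graph_def by blast
qed

text \<open>As the parts are disjoint, \<open>v\<close> is the \<open>U2\<close> end of both its
  edges, whose other ends are then two distinct vertices of \<open>U1\<close>.\<close>

lemma degree_2_neighbours:
  assumes H: "bipartite_with_parts H U1 U2" and v: "v \<in> U2" "degree H v = 2"
  shows "\<exists>a b. a \<in> U1 \<and> b \<in> U1 \<and> a \<noteq> b \<and> (\<forall>u\<in>U1. {u, v} \<in> edges H \<longrightarrow> u \<in> {a, b})"
proof -
  have disj: "U1 \<inter> U2 = {}" and edgesH: "\<forall>e\<in>edges H. \<exists>u\<in>U1. \<exists>v\<in>U2. e = {u, v}"
    using H unfolding bipartite_with_parts_def by auto
  obtain e1 e2 where e: "{e \<in> edges H. v \<in> e} = {e1, e2}" "e1 \<noteq> e2"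
    using v(2) unfolding degree_def card_2_iff by auto
  have ex: "\<exists>u\<in>U1. e = {u, v}" if "e \<in> {e1, e2}" for e
  proof -
    have "e \<in> edges H" "v \<in> e" using that e(1) by auto
    then obtain u v' where "u \<in> U1" "v' \<in> U2" "e = {u, v'}" using edgesH by meson
    moreover have "v \<noteq> u" using disj v(1) \<open>u \<in> U1\<close> by auto
    ultimately show ?thesis using \<open>v \<in> e\<close> by auto
  qed
  obtain a b where ab: "a \<in> U1" "e1 = {a, v}" "b \<in> U1" "e2 = {b, v}"
    using ex[of e1] ex[of e2] by auto
  have "u \<in> {a, b}" if u: "u \<in> U1" "{u, v} \<in> edges H" for u
  proof -
    have "{u, v} \<in> {e1, e2}" using u(2) unfolding e(1)[symmetric] by simp
    moreover have "u \<noteq> v" using disj u v(1) by auto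
    ultimately show ?thesis using ab by (auto simp: doubleton_eq_iff)
  qed
  moreover have "a \<noteq> b" using ab e(2) by auto
  ultimately show ?thesis using ab by metis
qed

section \<open>Choice of the parameters and the embedding of \<open>H\<close>\<close>

theorem theorem8p5:
  fixes \<epsilon> :: real and n N :: nat
    and G :: "'a ugraph" and H :: "'b ugraph" and U1 U2 :: "'b set"
  assumes "\<epsilon> > 0" and "n > 0"
    and "simple_graph G"
    and "card (verts G) = N"
    and "real N \<ge> 128 / \<epsilon> ^ 3 * real n"
    and "real (card (edges G)) = \<epsilon> * real N ^ 2"
    and "bipartite_with_parts H U1 U2"
    and "card (verts H) = n"
    and "\<forall>v\<in>U2. degree H v = 2"
  shows "contains_graph G H"
proof -
  have finV: "finite (verts G)" using assms(3) by (simp add: simple_graph_def)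
  obtain X where X: "X \<subseteq> verts G"
    and cut: "card (edges G) \<le> 2 * card {e \<in> edges G. \<exists>x\<in>X. \<exists>y\<in>verts G - X. e = {x, y}}"
      (is "_ \<le> 2 * card ?E")
    using exists_half_cut[OF finV, of "edges G"] assms(3) unfolding simple_graph_def by meson
  define Y where "Y = verts G - X"
  \<comment> \<open>The cut edges, written as pairs with the end in \<open>X\<close> first.\<close>
  define R where "R = {(x, y). x \<in> X \<and> y \<in> Y \<and> {x, y} \<in> edges G}"
  have finXY: "finite X" "finite Y" and cardXY: "card X \<le> N" "card Y \<le> N"
    using X finV assms(4) unfolding Y_def by (auto intro: finite_subset card_mono)
  have R: "R \<subseteq> X \<times> Y" unfolding R_def by auto
  have finR: "finite R" using R finXY finite_subset by blast
  have "?E = (\<lambda>(x, y). {x, y}) ` R" unfolding R_def Y_def by auto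
  then have "card ?E \<le> card R" using finR card_image_le by metis
  then have "real (card (edges G)) \<le> 2 * real (card R)" using cut by linarith
  then have eR: "\<epsilon> * real N ^ 2 \<le> 2 * real (card R)" using assms(6) by simp
  have "128 / \<epsilon> ^ 3 * real n > 0" using assms(1,2) by simp
  then have N_pos: "real N > 0" using assms(5) by linarith
  have "card R \<le> card (X \<times> Y)" by (rule card_mono) (use R finXY in auto)
  also have "\<dots> \<le> N * N" using cardXY by (simp add: card_cartesian_product mult_mono)
  finally have "real (card R) \<le> real N ^ 2" by (metis of_nat_le_iff of_nat_mult power2_eq_square)
  then have "\<epsilon> * real N ^ 2 \<le> 2 * real N ^ 2" using eR by linarith
  then have eps2: "\<epsilon> \<le> 2" using N_pos by simp
  \<comment> \<open>The crude bound \<open>\<epsilon> \<le> 2\<close> trades the cubic hypothesis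
    for a quadratic one, which matches the square of \<open>card R\<close>.\<close>
  have "128 * real n \<le> \<epsilon> ^ 3 * real N" using assms(1,5) by (simp add: field_simps)
  also have "\<dots> = \<epsilon> * (\<epsilon> ^ 2 * real N)" by (simp add: power2_eq_square power3_eq_cube)
  also have "\<dots> \<le> 2 * (\<epsilon> ^ 2 * real N)" using eps2 by (intro mult_right_mono) auto
  finally have e2N: "64 * real n \<le> \<epsilon> ^ 2 * real N" by linarith
  have nN: "real n \<le> real N"
  proof -
    have "\<epsilon> ^ 2 \<le> 2 ^ 2" using eps2 assms(1) by (intro power_mono) auto
    then have "\<epsilon> ^ 2 * real N \<le> 4 * real N" by (intro mult_right_mono) auto
    then show ?thesis using e2N by linarith
  qed
  \<comment> \<open>From \<open>1 \<le> n \<le> N\<close> the left side is at most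
    \<open>3 * n * N ^ 3\<close>. From \<open>card R \<ge> \<epsilon> * N ^ 2 / 2\<close> and
    \<open>e2N\<close> the right side is at least \<open>16 * n * N ^ 3\<close>.\<close>
  have "real N ^ 3 * real (n + 1) + real n ^ 2 * real N ^ 2 < real (card R) ^ 2"
  proof -
    have "real n ^ 2 * real N ^ 2 \<le> real n * real N ^ 3"
      using nN mult_right_mono[OF nN, of "real n * real N ^ 2"]
      by (simp add: power2_eq_square power3_eq_cube algebra_simps)
    moreover have "real N ^ 3 * 1 \<le> real N ^ 3 * real n" using assms(2) by (intro mult_left_mono) auto
    ultimately have "real N ^ 3 * real (n + 1) + real n ^ 2 * real N ^ 2 \<le> 3 * (real n * real N ^ 3)"
      by (simp add: algebra_simps)
    also have "\<dots> < 16 * (real n * real N ^ 3)" using N_pos assms(2) by simp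
    also have "\<dots> \<le> \<epsilon> ^ 2 * real N ^ 4 / 4"
      using mult_right_mono[OF e2N, of "real N ^ 3"] by (simp add: power_numeral_reduce algebra_simps)
    also have "\<dots> = (\<epsilon> * real N ^ 2 / 2) ^ 2" by (simp add: power_mult_distrib power_divide)
    also have "\<dots> \<le> real (card R) ^ 2" using eR assms(1) by (intro power_mono) auto
    finally show ?thesis .
  qed
  note dependent_choice_inverse_codegree[OF R finXY(1) cardXY(1) finXY(2) cardXY(2) this]
  then obtain t where t: "t \<in> Y" "n \<le> card {x. (x, t) \<in> R}"
    and W: "real n * (\<Sum>x\<in>{x. (x, t) \<in> R}. \<Sum>y\<in>{x. (x, t) \<in> R} - {x}.
        1 / real (card {s. (x, s) \<in> R \<and> (y, s) \<in> R}))
      \<le> real (card {x. (x, t) \<in> R} * (card {x. (x, t) \<in> R} - 1))"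
    by blast
  define A where "A = {x. (x, t) \<in> R}"
  define cod where "cod x y = {s. (x, s) \<in> R \<and> (y, s) \<in> R}" for x y
  have AX: "A \<subseteq> X" using R unfolding A_def by auto
  have finA: "finite A" using AX finXY(1) finite_subset by blast
  have codY: "cod x y \<subseteq> Y" for x y using R unfolding cod_def by auto
  have H: "simple_graph H" "verts H = U1 \<union> U2" "U1 \<inter> U2 = {}"
    and edgesH: "\<And>e. e \<in> edges H \<Longrightarrow> \<exists>u\<in>U1. \<exists>v\<in>U2. e = {u, v}"
    using assms(7) unfolding bipartite_with_parts_def by auto
  have fins: "finite U1" "finite U2" using H(1,2) unfolding simple_graph_def by auto
  have U_le: "card U1 \<le> n" "card U2 \<le> n"
    using assms(8) H(2) fins by (auto intro: card_mono)
  \<comment> \<open>Any injection will do here: following it by a random permutation of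
    \<open>A\<close> makes it a random injection.\<close>
  then obtain h where h: "h ` U1 \<subseteq> A" "inj_on h U1"
    using card_le_inj[OF fins(1) finA] t(2) unfolding A_def by (meson le_trans)
  obtain a b where ab: "\<And>v. v \<in> U2 \<Longrightarrow> a v \<in> U1 \<and> b v \<in> U1 \<and> a v \<noteq> b v"
    and nbs: "\<And>u v. v \<in> U2 \<Longrightarrow> u \<in> U1 \<Longrightarrow> {u, v} \<in> edges H \<Longrightarrow> u = a v \<or> u = b v"
    using degree_2_neighbours[OF assms(7)] assms(9) by (metis insertE singletonD)
  have "h (a v) \<in> A \<and> h (b v) \<in> A \<and> h (a v) \<noteq> h (b v)" if "v \<in> U2" for v
    using ab[OF that] h by (auto dest: inj_onD)
  note hab = this
  obtain p where p: "p permutes A"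
    and sum_p: "real (card A * (card A - 1)) * (\<Sum>v\<in>U2. 1 / real (card (cod (p (h (a v))) (p (h (b v))))))
      \<le> real (card U2) * (\<Sum>x\<in>A. \<Sum>y\<in>A - {x}. 1 / real (card (cod x y)))"
    using exists_permutation_sum_pairs_le[where J = U2 and a = "h \<circ> a" and b = "h \<circ> b"
        and w = "\<lambda>x y. 1 / real (card (cod x y))", OF finA] hab by auto
  define f where "f = p \<circ> h"
  have f: "inj_on f U1" "f ` U1 \<subseteq> A"
    using h p unfolding f_def
    by (auto simp: permutes_in_image intro: comp_inj_on inj_on_subset[OF permutes_inj[OF p]])
  have sum_le: "(\<Sum>v\<in>U2. 1 / real (card (cod (f (a v)) (f (b v))))) \<le> 1"
  \<comment> \<open>A vertex of \<open>U2\<close> forces \<open>card A \<ge> 2\<close>, so the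
    number of pairs is positive and can be cancelled.\<close>
  proof (cases "U2 = {}")
    case False
    then obtain v where "v \<in> U2" by blast
    then have "{h (a v), h (b v)} \<subseteq> A" "card {h (a v), h (b v)} = 2"
      using hab[of v] by auto
    then have "2 \<le> card A" using card_mono[OF finA] by metis
    then have D: "real (card A * (card A - 1)) > 0" by simp
    have "real (card U2) * (\<Sum>x\<in>A. \<Sum>y\<in>A - {x}. 1 / real (card (cod x y)))
        \<le> real n * (\<Sum>x\<in>A. \<Sum>y\<in>A - {x}. 1 / real (card (cod x y)))"
      using U_le(2) by (intro mult_right_mono sum_nonneg) auto
    also have "\<dots> \<le> real (card A * (card A - 1)) * 1" using W unfolding A_def cod_def by simp
    finally show ?thesis
      using order.trans[OF sum_p] D unfolding f_def comp_def by (meson mult_le_cancel_left_pos)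
  qed simp
  \<comment> \<open>\<open>t\<close> is itself a common neighbour of any two elements of
    \<open>A\<close>. So no term of \<open>sum_le\<close> is a spurious
    \<open>1 / 0 = 0\<close>.\<close>
  have "finite (cod (f (a v)) (f (b v))) \<and> cod (f (a v)) (f (b v)) \<noteq> {}" if "v \<in> U2" for v
  proof -
    have "f (a v) \<in> A" "f (b v) \<in> A" using f(2) ab[OF that] by auto
    then have "t \<in> cod (f (a v)) (f (b v))" unfolding cod_def A_def by simp
    then show ?thesis using codY finXY(2) finite_subset by blast
  qed
  from distinct_representatives_if_sum_inverse_card_le_1[OF fins(2) this sum_le]
  obtain g where g: "inj_on g U2" "\<And>v. v \<in> U2 \<Longrightarrow> g v \<in> cod (f (a v)) (f (b v))" by blast
  define \<phi> where "\<phi> v = (if v \<in> U1 then f v else g v)" for v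
  have \<phi>1: "\<phi> v = f v" if "v \<in> U1" for v using that by (simp add: \<phi>_def)
  have \<phi>2: "\<phi> v = g v" if "v \<in> U2" for v using that H(3) by (auto simp: \<phi>_def)
  have im1: "\<phi> ` U1 \<subseteq> X" using f(2) AX \<phi>1 by auto
  have im2: "\<phi> ` U2 \<subseteq> Y" using g(2) codY \<phi>2 by fastforce
  show ?thesis
  proof (rule contains_graph_if_embedding[OF H(1), of \<phi>])
    have "inj_on \<phi> U1" "inj_on \<phi> U2"
      using f(1) g(1) \<phi>1 \<phi>2 by (simp_all cong: inj_on_cong)
    \<comment> \<open>The two halves cannot collide, as they lie on opposite sides of the
      cut.\<close>
    moreover have "\<phi> ` U1 \<inter> \<phi> ` U2 = {}" using im1 im2 unfolding Y_def by blast
    ultimately show "inj_on \<phi> (verts H)" unfolding H(2) by (auto simp: inj_on_Un)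
    show "\<phi> ` verts H \<subseteq> verts G" using im1 im2 X unfolding H(2) Y_def by blast
  next
    fix e assume "e \<in> edges H"
    then obtain u v where uv: "u \<in> U1" "v \<in> U2" "e = {u, v}" using edgesH by blast
    then have "u = a v \<or> u = b v" using nbs \<open>e \<in> edges H\<close> by auto
    then have "(f u, g v) \<in> R" using g(2)[OF uv(2)] unfolding cod_def by auto
    then show "\<phi> ` e \<in> edges G" using uv \<phi>1 \<phi>2 unfolding R_def by auto
  qed
qed

end
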